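(* Let $K$ be an algebraically closed field of characteristic $0$ and let $\Gamma\colon A=A_0\oplus A_1$ be a $\mathbb Z_2$-graded regular $K$-algebra. Then $A$ satisfies the primeness property for (ordinary) central polynomials.
   Context: Algebras are associative. For a finite abelian group $G$, a $G$-grading $A=\bigoplus_{g\in G}A_g$ (with $A_gA_h\subseteq A_{g+h}$) is regular if (i) for every $n\in\mathbb N$ and $(g_1,\dots,g_n)\in G^n$ there exist $a_i\in A_{g_i}$ with $a_1\cdots a_n\neq 0$; and (ii) for every $g,h\in G$ there is a scalar $\beta(g,h)\in K^*$, depending only on $g,h$, such that $a_ga_h=\beta(g,h)a_ha_g$ for all $a_g\in A_g$, $a_h\in A_h$. $K\langle X\rangle$ is the free unitary associative algebra on a countably infinite set $X$ of variables. A polynomial $f\in K\langle X\rangle$ is a central polynomial of an algebra $R$ if all its values on $R$ lie in the centre of $R$; it is proper if it is not a polynomial identity of $R$. $R$ satisfies the primeness property for central polynomials if, whenever $f,g\in K\langle X\rangle$ are polynomials in disjoint sets of variables such that $fg$ is a proper central polynomial of $R$, both $f$ and $g$ are central polynomials of $R$. *)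

theory Defs
  imports
    "HOL-Library.Poly_Mapping"
    "HOL-Library.Numeral_Type"
    "HOL-Computational_Algebra.Polynomial"
begin

section \<open>The free unitary associative algebra\<close>

text \<open>
  The free monoid is written additively, because the product of
  \<^theory>\<open>HOL-Library.Poly_Mapping\<close> is the convolution product over a
  \<^class>\<open>monoid_add\<close>. Hence \<open>0\<close> is the empty word, and \<open>'k free_algebra\<close> below is
  the monoid algebra of the free monoid on the countably infinite set of variables
  \<open>UNIV :: nat set\<close>, with its library ring structure.
\<close>

datatype 'x free_monoid = Word (letters: "'x list")

instantiation free_monoid :: (type) monoid_add
begin

definition zero_free_monoid :: "'a free_monoid"
  where "0 = Word []"

definition plus_free_monoid :: "'a free_monoid \<Rightarrow> 'a free_monoid \<Rightarrow> 'a free_monoid"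
  where "u + v = Word (letters u @ letters v)"

instance
  by standard (simp_all add: zero_free_monoid_def plus_free_monoid_def)

end

type_synonym 'k free_algebra = "nat free_monoid \<Rightarrow>\<^sub>0 'k"

definition variables :: "'k::zero free_algebra \<Rightarrow> nat set"
  where "variables f = (\<Union>w \<in> Poly_Mapping.keys f. set (letters w))"


section \<open>Associative algebras, with or without unity\<close>

definition is_unity :: "'a::ring \<Rightarrow> bool"
  where "is_unity e \<longleftrightarrow> (\<forall>a. e * a = a \<and> a * e = a)"

definition unital :: "'a::ring itself \<Rightarrow> bool"
  where "unital _ \<longleftrightarrow> (\<exists>e::'a. is_unity e)"

definition centre :: "'a::ring set"
  where "centre = {z. \<forall>a. z * a = a * z}"

text \<open>The product of a nonempty list; its value on the empty list is irrelevant.\<close>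

definition list_product :: "'a::ring list \<Rightarrow> 'a"
  where "list_product as = foldl (*) (hd as) (tl as)"

text \<open>The empty word is sent to the unity; see \<open>evaluable\<close> for the non-unital case.\<close>

definition word_value :: "(nat \<Rightarrow> 'a::ring) \<Rightarrow> nat free_monoid \<Rightarrow> 'a"
  where "word_value a w =
    (if w = 0 then (THE e. is_unity e) else list_product (map a (letters w)))"

text \<open>
  The polynomials that have values in an algebra with carrier type \<open>'a\<close>: all of them if
  the algebra has a unity, and those with zero constant term otherwise.
\<close>

definition evaluable :: "'a::ring itself \<Rightarrow> 'k::zero free_algebra \<Rightarrow> bool"
  where "evaluable A f \<longleftrightarrow> unital A \<or> Poly_Mapping.lookup f 0 = 0"

locale assoc_algebra = vector_space scale
  for scale :: "'k::field \<Rightarrow> 'a::ring \<Rightarrow> 'a" +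
  assumes scale_mult_left: "scale c a * b = scale c (a * b)"
    and scale_mult_right: "a * scale c b = scale c (a * b)"
begin

section \<open>Regular gradings\<close>

definition grading :: "('g::{finite,ab_group_add} \<Rightarrow> 'a set) \<Rightarrow> bool"
  where "grading A \<longleftrightarrow>
    (\<forall>g. subspace (A g)) \<and>
    (\<forall>a. \<exists>!c. (\<forall>g. c g \<in> A g) \<and> a = (\<Sum>g\<in>UNIV. c g)) \<and>
    (\<forall>g h. \<forall>a\<in>A g. \<forall>b\<in>A h. a * b \<in> A (g + h))"

definition regular_grading :: "('g::{finite,ab_group_add} \<Rightarrow> 'a set) \<Rightarrow> bool"
  where "regular_grading A \<longleftrightarrow>
    grading A \<and>
    (\<forall>gs. gs \<noteq> [] \<longrightarrow>
      (\<exists>as. list_all2 (\<lambda>a g. a \<in> A g) as gs \<and> list_product as \<noteq> 0)) \<and>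
    (\<exists>\<beta>. \<forall>g h. \<beta> g h \<noteq> 0 \<and>
      (\<forall>a\<in>A g. \<forall>b\<in>A h. a * b = scale (\<beta> g h) (b * a)))"


section \<open>Central polynomials\<close>

definition poly_value :: "'k free_algebra \<Rightarrow> (nat \<Rightarrow> 'a) \<Rightarrow> 'a"
  where "poly_value f a =
    (\<Sum>w \<in> Poly_Mapping.keys f. scale (Poly_Mapping.lookup f w) (word_value a w))"

definition central_polynomial :: "'k free_algebra \<Rightarrow> bool"
  where "central_polynomial f \<longleftrightarrow>
    evaluable TYPE('a) f \<and> (\<forall>a. poly_value f a \<in> centre)"

definition polynomial_identity :: "'k free_algebra \<Rightarrow> bool"
  where "polynomial_identity f \<longleftrightarrow>
    evaluable TYPE('a) f \<and> (\<forall>a. poly_value f a = 0)"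

definition proper_central_polynomial :: "'k free_algebra \<Rightarrow> bool"
  where "proper_central_polynomial f \<longleftrightarrow>
    central_polynomial f \<and> \<not> polynomial_identity f"

text \<open>
  If the algebra has a unity, the two evaluability conditions are void and \<open>f\<close>, \<open>g\<close> range
  over the whole free algebra.
\<close>

definition primeness_property :: bool
  where "primeness_property \<longleftrightarrow>
    (\<forall>f g. evaluable TYPE('a) f \<longrightarrow> evaluable TYPE('a) g \<longrightarrow>
      variables f \<inter> variables g = {} \<longrightarrow>
      proper_central_polynomial (f * g) \<longrightarrow>
      central_polynomial f \<and> central_polynomial g)"

end

end

theory Submission
  imports Defs "HOL-Combinatorics.Multiset_Permutations"
begin

text \<open>
  If the odd part of \<open>A\<close> commutes with itself, then \<open>A\<close> is commutative and there is nothing to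
  prove. Otherwise \<open>A\<close> is supercommutative: even elements are central and odd elements
  anticommute. The proof of this case rests on two ideas.

  \<^bold>\<open>Values produce products of homogeneous elements.\<close> Let all values of \<open>f\<close> lie in a subspace
  \<open>V\<close>. Polarising \<open>f\<close> (characteristic 0) yields multilinear expressions with values in \<open>V\<close>,
  and on homogeneous arguments such an expression is \<open>C \<cdot> b\<^sub>1 \<cdots> b\<^sub>l\<close>, where \<open>C\<close> depends on the
  degrees of the \<open>b\<^sub>j\<close> only. The values of \<open>f\<close> are recovered from these expressions, so if some
  value lies outside a subspace \<open>W\<close>, then one of them has \<open>C \<noteq> 0\<close>. Hence, for some
  list of degrees, \<^emph>\<open>all\<close> products of elements of these degrees lie in \<open>V\<close>, and one of them lies
  outside \<open>W\<close> (\<open>homogeneous_products_from_values\<close>). Regularity says that products of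
  prescribed degrees do not vanish identically, so a \<open>V\<close> that annihilates too much is impossible.

  \<^bold>\<open>A polynomial with only odd values is an identity\<close> (\<open>odd_valued_imp_zero\<close>). For odd \<open>\<eta>\<close>, the map
  \<open>a \<mapsto> a + [\<eta>, a]/2\<close> is an endomorphism of \<open>A\<close>, being conjugation by \<open>1 + \<eta>/2\<close>
  (in \<open>A\<close> with a unity adjoined). It sends an odd value \<open>y\<close> to the value \<open>y + \<eta>y\<close>, which is again odd; so the even element \<open>\<eta>y\<close> vanishes.
  Thus \<open>\<eta>\<close> annihilates all values, hence all products of homogeneous elements of some
  degrees, against regularity.

  Now let \<open>fg\<close> be a proper central polynomial. The variables are disjoint, so \<open>f(a)g(b)\<close> is
  central for independent \<open>a\<close>, \<open>b\<close>. Suppose that \<open>f\<close> is not central. By the first idea, \<open>f\<close> may be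
  replaced by products of total degree 1 (those of total degree 0 are central). As \<open>g\<close> is not
  an identity, it has a value that is not odd, so \<open>g\<close> may be replaced by products of total degree 0.
  Then every \<open>f\<close>-product times every \<open>g\<close>-product is odd and central, so it annihilates all odd
  elements, and this contradicts regularity. The argument for \<open>g\<close> is the same, because
  commutators in \<open>A\<close> are central and therefore \<open>g(b)f(a)\<close> is central as well.
\<close>

section \<open>Products of lists\<close>

text \<open>
  The value of a word as a function of the list of its letters' values. On the empty list it
  is the unity, if there is one; in an algebra without unity the empty product is a
  junk value, and the lemmas below carry the guard \<open>unital TYPE('a) \<or> xs \<noteq> []\<close> to exclude it.
\<close>

definition word_product :: "'a::ring list \<Rightarrow> 'a"
  where "word_product as = (if as = [] then (THE e. is_unity e) else list_product as)"

lemma word_value_eq: "word_value a (Word xs) = word_product (map a xs)"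
  by (simp add: word_value_def word_product_def zero_free_monoid_def)

lemma foldl_mult: "foldl (*) (x * y) zs = x * foldl (*) y (zs :: 'a::ring list)"
  by (induction zs arbitrary: y) (simp_all add: mult.assoc)

lemma word_product_single [simp]: "word_product [x] = x"
  by (simp add: word_product_def list_product_def)

lemma word_product_Cons: "zs \<noteq> [] \<Longrightarrow> word_product (x # zs) = x * word_product zs"
  by (cases zs) (simp_all add: word_product_def list_product_def foldl_mult)

lemma is_unity_The: "unital TYPE('a::ring) \<Longrightarrow> is_unity (THE e::'a. is_unity e)"
  unfolding unital_def by (erule exE, rule theI) (auto simp: is_unity_def, metis)

lemma word_product_Nil: "unital TYPE('a::ring) \<Longrightarrow> is_unity (word_product [] :: 'a)"
  by (simp add: word_product_def is_unity_The)

lemma word_product_append: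
  fixes xs ys :: "'a::ring list"
  assumes "unital TYPE('a) \<or> xs \<noteq> []" "unital TYPE('a) \<or> ys \<noteq> []"
  shows "word_product (xs @ ys) = word_product xs * word_product ys"
proof (cases "ys = []")
  case True
  then show ?thesis using assms word_product_Nil[where 'a='a] by (simp add: is_unity_def)
next
  case ys: False
  show ?thesis
  proof (cases "xs = []")
    case True
    then show ?thesis using assms word_product_Nil[where 'a='a] by (simp add: is_unity_def)
  next
    case False
    then show ?thesis
    proof (induction xs)
      case (Cons x xs)
      then show ?case using ys
        by (cases "xs = []") (simp_all add: word_product_Cons mult.assoc)
    qed simp
  qed
qed

text \<open>
  Expanding a product of sums. The letters \<open>x\<close> of \<open>w\<close> stand for sums over the fibres of a labelling
  \<open>\<pi>\<close>, so the summands of the product are indexed by the lists of indices that are labelled \<open>w\<close>.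
  This form serves both for sums of scaled test elements placed at chosen variables and for
  decompositions into homogeneous components. The empty word causes no exception: both sides
  are the empty product.
\<close>

lemma word_product_fibre_sums:
  fixes q :: "'j \<Rightarrow> 'a::ring"
  assumes J: "finite J"
  shows "word_product (map (\<lambda>x. \<Sum>k | k \<in> J \<and> \<pi> k = x. q k) w)
    = (\<Sum>ks | ks \<in> lists J \<and> map \<pi> ks = w. word_product (map q ks))"
proof (cases "w = []")
  case True
  then have "{ks. ks \<in> lists J \<and> map \<pi> ks = w} = {[]}" by auto
  then show ?thesis using True by simp
next
  case False
  then show ?thesis
  proof (induction w)
    case (Cons x w)
    let ?F = "{k. k \<in> J \<and> \<pi> k = x}" and ?R = "{ks. ks \<in> lists J \<and> map \<pi> ks = w}"
    have split: "{ks. ks \<in> lists J \<and> map \<pi> ks = x # w} = (\<lambda>(k, ks). k # ks) ` (?F \<times> ?R)"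
      by (auto simp: image_def Cons_eq_map_conv map_eq_Cons_conv)
    have inj: "inj_on (\<lambda>(k, ks). k # ks) (?F \<times> ?R)" by (auto simp: inj_on_def)
    have sum: "(\<Sum>ks | ks \<in> lists J \<and> map \<pi> ks = x # w. word_product (map q ks))
        = (\<Sum>k\<in>?F. \<Sum>ks\<in>?R. word_product (q k # map q ks))"
      unfolding split sum.reindex[OF inj] by (simp add: sum.cartesian_product case_prod_beta)
    show ?case
    proof (cases "w = []")
      case True
      then have "?R = {[]}" by auto
      then show ?thesis unfolding sum using True by simp
    next
      case False
      then have "word_product (q k # map q ks) = q k * word_product (map q ks)" if "ks \<in> ?R" for k ks
        using that by (intro word_product_Cons) auto
      then show ?thesis
        unfolding sum using False Cons.IH by (simp add: word_product_Cons sum_product)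
    qed
  qed simp
qed

section \<open>Evaluation of polynomials\<close>

context assoc_algebra
begin

lemma centre_subspace: "subspace centre"
  unfolding subspace_def centre_def
  by (auto simp: distrib_left distrib_right scale_mult_left scale_mult_right)

lemma poly_value_alt:
  "poly_value f a = (\<Sum>w\<in>Poly_Mapping.keys f.
     scale (Poly_Mapping.lookup f w) (word_product (map a (letters w))))"
  unfolding poly_value_def by (rule sum.cong) (use word_value_eq in \<open>metis free_monoid.collapse\<close>)+

lemma poly_value_cong:
  assumes "\<And>x. x \<in> variables f \<Longrightarrow> a x = b x"
  shows "poly_value f a = poly_value f b"
  unfolding poly_value_alt
proof (rule sum.cong[OF refl])
  fix w assume "w \<in> Poly_Mapping.keys f"
  then have "map a (letters w) = map b (letters w)"
    using assms by (auto simp: variables_def)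
  then show "scale (Poly_Mapping.lookup f w) (word_product (map a (letters w)))
      = scale (Poly_Mapping.lookup f w) (word_product (map b (letters w)))" by (simp only:)
qed

lemma finite_variables: "finite (variables f)"
  by (simp add: variables_def)

lemma evaluable_word:
  assumes "evaluable TYPE('a) f" "w \<in> Poly_Mapping.keys f"
  shows "unital TYPE('a) \<or> letters w \<noteq> []"
  using assms by (cases w) (auto simp: evaluable_def zero_free_monoid_def in_keys_iff)

lemma poly_value_mult:
  assumes f: "evaluable TYPE('a) f" and g: "evaluable TYPE('a) g"
  shows "poly_value (f * g) a = poly_value f a * poly_value g a"
proof -
  let ?S = "{u + v | u v. u \<in> Poly_Mapping.keys f \<and> v \<in> Poly_Mapping.keys g}"
  let ?P = "\<lambda>w. word_product (map a (letters w))"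
  let ?f = "Poly_Mapping.lookup f" and ?g = "Poly_Mapping.lookup g"
  have finS: "finite ?S"
    by (rule finite_subset[of _ "(\<lambda>(u,v). u + v) ` (Poly_Mapping.keys f \<times> Poly_Mapping.keys g)"]) auto
  have sub: "Poly_Mapping.keys (f * g) \<subseteq> ?S" using keys_mult[of f g] .
  have lk: "Poly_Mapping.lookup (f * g) w =
      (\<Sum>u\<in>Poly_Mapping.keys f. \<Sum>v\<in>Poly_Mapping.keys g. (?f u * ?g v when w = u + v))" for w
  proof -
    have "Poly_Mapping.lookup (f * g) w = (\<Sum>u. ?f u * (\<Sum>v. ?g v when w = u + v))"
      by (simp add: lookup_mult)
    also have "\<dots> = (\<Sum>u\<in>Poly_Mapping.keys f. ?f u * (\<Sum>v. ?g v when w = u + v))"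
      by (rule Sum_any.expand_superset) (auto simp: in_keys_iff)
    also have "\<dots> = (\<Sum>u\<in>Poly_Mapping.keys f. ?f u * (\<Sum>v\<in>Poly_Mapping.keys g. ?g v when w = u + v))"
      by (intro sum.cong refl arg_cong[where f="(*) _"] Sum_any.expand_superset) (auto simp: in_keys_iff)
    finally show ?thesis by (simp add: sum_distrib_left mult_when)
  qed
  have "poly_value (f * g) a = (\<Sum>w\<in>?S. scale (Poly_Mapping.lookup (f * g) w) (?P w))"
    unfolding poly_value_alt by (rule sum.mono_neutral_left[OF finS sub]) (auto simp: in_keys_iff)
  also have "\<dots> = (\<Sum>w\<in>?S. \<Sum>u\<in>Poly_Mapping.keys f. \<Sum>v\<in>Poly_Mapping.keys g.
      (if w = u + v then scale (?f u * ?g v) (?P w) else 0))"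
    unfolding lk scale_sum_left by (intro sum.cong refl) (simp add: when_def)
  also have "\<dots> = (\<Sum>u\<in>Poly_Mapping.keys f. \<Sum>v\<in>Poly_Mapping.keys g. \<Sum>w\<in>?S.
      (if w = u + v then scale (?f u * ?g v) (?P w) else 0))"
    by (subst sum.swap, rule sum.cong[OF refl], rule sum.swap)
  also have "\<dots> = (\<Sum>u\<in>Poly_Mapping.keys f. \<Sum>v\<in>Poly_Mapping.keys g. scale (?f u * ?g v) (?P (u + v)))"
    by (intro sum.cong refl, subst sum.delta[OF finS]) auto
  also have "\<dots> = (\<Sum>u\<in>Poly_Mapping.keys f. \<Sum>v\<in>Poly_Mapping.keys g.
      scale (?f u) (?P u) * scale (?g v) (?P v))"
  proof (intro sum.cong refl)
    fix u v assume "u \<in> Poly_Mapping.keys f" "v \<in> Poly_Mapping.keys g"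
    then have "?P (u + v) = ?P u * ?P v"
      using evaluable_word[OF f] evaluable_word[OF g]
      by (auto simp: plus_free_monoid_def word_product_append)
    then show "scale (?f u * ?g v) (?P (u + v)) = scale (?f u) (?P u) * scale (?g v) (?P v)"
      by (simp add: scale_mult_left scale_mult_right)
  qed
  also have "\<dots> = poly_value f a * poly_value g a"
    unfolding poly_value_alt by (simp add: sum_product)
  finally show ?thesis .
qed

lemma poly_value_endomorphism:
  assumes f: "evaluable TYPE('a) f"
    and add: "\<And>x y. \<phi> (x + y) = \<phi> x + \<phi> y" and scal: "\<And>c x. \<phi> (scale c x) = scale c (\<phi> x)"
    and mult: "\<And>x y. \<phi> (x * y) = \<phi> x * \<phi> y"
    and unit: "\<And>e. is_unity e \<Longrightarrow> \<phi> e = e"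
  shows "poly_value f (\<lambda>x. \<phi> (a x)) = \<phi> (poly_value f a)"
proof -
  have zero: "\<phi> 0 = 0" using scal[of 0 0] by simp
  have sum: "\<phi> (sum h S) = (\<Sum>s\<in>S. \<phi> (h s))" if "finite S" for h :: "nat free_monoid \<Rightarrow> 'a" and S
    using that by induction (simp_all add: add zero)
  have word: "word_product (map (\<lambda>x. \<phi> (a x)) xs) = \<phi> (word_product (map a xs))"
    if "unital TYPE('a) \<or> xs \<noteq> []" for xs
  proof (cases "xs = []")
    case True
    then show ?thesis using unit word_product_Nil[where 'a='a] that by simp
  next
    case False
    then show ?thesis
    proof (induction xs)
      case (Cons x xs)
      then show ?case by (cases "xs = []") (simp_all add: word_product_Cons mult)
    qed simp
  qed
  show ?thesis
    unfolding poly_value_alt using word evaluable_word[OF f]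
    by (simp add: sum scal)
qed

lemma poly_value_fibre_sums:
  fixes q :: "'j \<Rightarrow> 'a"
  assumes J: "finite J"
  shows "poly_value f (\<lambda>x. \<Sum>k | k \<in> J \<and> \<pi> k = x. q k)
    = (\<Sum>ks | ks \<in> lists J \<and> Word (map \<pi> ks) \<in> Poly_Mapping.keys f.
        scale (Poly_Mapping.lookup f (Word (map \<pi> ks))) (word_product (map q ks)))" (is "_ = sum ?h ?K")
    and "finite {ks. ks \<in> lists J \<and> Word (map \<pi> ks) \<in> Poly_Mapping.keys f}"
proof -
  let ?N = "length ` letters ` Poly_Mapping.keys f"
  have "?K \<subseteq> (\<Union>n\<in>?N. {ks. set ks \<subseteq> J \<and> length ks = n})" by force
  moreover have "finite (\<Union>n\<in>?N. {ks. set ks \<subseteq> J \<and> length ks = n})"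
    using finite_lists_length_eq[OF J] by simp
  ultimately show finK: "finite ?K" by (rule finite_subset)
  have "poly_value f (\<lambda>x. \<Sum>k | k \<in> J \<and> \<pi> k = x. q k) = (\<Sum>w\<in>Poly_Mapping.keys f.
      \<Sum>ks | ks \<in> lists J \<and> map \<pi> ks = letters w. ?h ks)"
    unfolding poly_value_alt word_product_fibre_sums[OF J] scale_sum_right
    by (intro sum.cong refl) auto
  also have "\<dots> = (\<Sum>w\<in>Poly_Mapping.keys f. sum ?h {ks \<in> ?K. Word (map \<pi> ks) = w})"
    by (intro sum.cong refl) (auto simp: free_monoid.expand)
  also have "\<dots> = sum ?h ?K"
    by (rule sum.group[OF finK]) auto
  finally show "poly_value f (\<lambda>x. \<Sum>k | k \<in> J \<and> \<pi> k = x. q k) = sum ?h ?K" .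
qed


end

section \<open>Polarisation\<close>

locale char_0_algebra = assoc_algebra scale
  for scale :: "'k::field_char_0 \<Rightarrow> 'a::ring \<Rightarrow> 'a"
begin

lemma subspace_scale_cancel:
  assumes V: "subspace V" and "c \<noteq> 0" and "scale c x \<in> V"
  shows "x \<in> V"
  using subspace_scale[OF V \<open>scale c x \<in> V\<close>, of "inverse c"] \<open>c \<noteq> 0\<close> by simp

lemma eq_minus_imp_zero:
  assumes "x = - x"
  shows "x = (0::'a)"
proof -
  have "x + x = 0" using assms by (metis add.right_inverse)
  then have "scale 2 x = 0" using scale_left_distrib[of 1 1 x] by simp
  then show ?thesis by simp
qed

text \<open>
  The coefficients of a vector-valued polynomial lie in every subspace that contains its
  values. Instead of inverting a Vandermonde matrix, the top coefficient is eliminated: in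
  \<open>F(2t) - 2\<^bsup>N+1\<^esup> F(t)\<close> the remaining coefficients are only multiplied by
  \<open>2\<^bsup>n\<^esup> - 2\<^bsup>N+1\<^esup>\<close>, which is nonzero in characteristic 0.
\<close>

lemma vandermonde_subspace:
  fixes Y :: "nat \<Rightarrow> 'a"
  assumes V: "subspace V"
    and val: "\<And>t. (\<Sum>n\<le>N. scale (t ^ n) (Y n)) \<in> V"
    and n: "n \<le> N"
  shows "Y n \<in> V"
  using val n
proof (induction N arbitrary: Y n)
  case 0
  then show ?case using "0.prems"(1)[of 0] by simp
next
  case (Suc N)
  have low: "Y m \<in> V" if m: "m \<le> N" for m
  proof -
    \<comment> \<open>The coefficients of \<open>F(2t) - 2\<^bsup>N+1\<^esup> F(t)\<close>, where \<open>F(t) = \<Sum>\<^sub>n t\<^bsup>n\<^esup> Y\<^sub>n\<close>.\<close>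
    let ?Z = "\<lambda>n. scale (2 ^ n - 2 ^ Suc N) (Y n)"
    have "?Z m \<in> V"
    proof (rule Suc.IH[OF _ m])
      fix t
      have "(\<Sum>n\<le>N. scale (t ^ n) (?Z n)) = (\<Sum>n\<le>Suc N. scale (t ^ n) (?Z n))" by simp
      also have "\<dots> = (\<Sum>n\<le>Suc N. scale ((2 * t) ^ n) (Y n)) - scale (2 ^ Suc N) (\<Sum>n\<le>Suc N. scale (t ^ n) (Y n))"
        unfolding scale_sum_right sum_subtractf[symmetric]
        by (intro sum.cong refl) (simp add: power_mult_distrib scale_left_diff_distrib scale_right_diff_distrib mult.commute)
      also have "\<dots> \<in> V"
        by (intro subspace_diff[OF V] subspace_scale[OF V] Suc.prems(1))
      finally show "(\<Sum>n\<le>N. scale (t ^ n) (?Z n)) \<in> V" .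
    qed
    moreover have "(2 ^ m - 2 ^ Suc N :: 'k) \<noteq> 0"
    proof -
      have "(2::nat) ^ m < 2 ^ Suc N" using m by (intro power_strict_increasing) auto
      then have "of_nat (2 ^ m) \<noteq> (of_nat (2 ^ Suc N) :: 'k)" unfolding of_nat_eq_iff by simp
      then show ?thesis by simp
    qed
    ultimately show ?thesis by (rule subspace_scale_cancel[OF V, rotated])
  qed
  show ?case
  proof (cases "n \<le> N")
    case False
    have "(\<Sum>n\<le>Suc N. scale (1 ^ n) (Y n)) - (\<Sum>n\<le>N. Y n) \<in> V"
      by (intro subspace_diff[OF V] subspace_sum[OF V] Suc.prems(1)) (use low in auto)
    then show ?thesis using False Suc.prems(2) le_Suc_eq by auto
  qed (rule low)
qed

lemma coefficient_extraction_single: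
  fixes X :: "'s \<Rightarrow> 'a" and e :: "'s \<Rightarrow> nat"
  assumes V: "subspace V" and I: "finite I"
    and val: "\<And>t. (\<Sum>s\<in>I. scale (t ^ e s) (X s)) \<in> V"
  shows "(\<Sum>s | s \<in> I \<and> e s = n. X s) \<in> V"
proof -
  define N where "N = Max (insert n (e ` I))"
  have N: "n \<le> N" "\<And>s. s \<in> I \<Longrightarrow> e s \<le> N" using I by (auto simp: N_def)
  show ?thesis
  proof (rule vandermonde_subspace[OF V _ N(1)])
    fix t
    have "(\<Sum>n\<le>N. scale (t ^ n) (\<Sum>s | s \<in> I \<and> e s = n. X s))
        = (\<Sum>n\<le>N. \<Sum>s | s \<in> I \<and> e s = n. scale (t ^ e s) (X s))"
      unfolding scale_sum_right by (intro sum.cong refl) auto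
    also have "\<dots> = (\<Sum>s\<in>I. scale (t ^ e s) (X s))"
      using N by (intro sum.group[OF I]) auto
    finally show "(\<Sum>n\<le>N. scale (t ^ n) (\<Sum>s | s \<in> I \<and> e s = n. X s)) \<in> V" using val by simp
  qed
qed

lemma coefficient_extraction:
  fixes X :: "'s \<Rightarrow> 'a" and e :: "'s \<Rightarrow> nat \<Rightarrow> nat"
  assumes V: "subspace V" and I: "finite I"
    and val: "\<And>t. (\<Sum>s\<in>I. scale (\<Prod>j<l. t j ^ e s j) (X s)) \<in> V"
  shows "(\<Sum>s | s \<in> I \<and> (\<forall>j<l. e s j = m j). X s) \<in> V"
  using I val
proof (induction l arbitrary: I)
  case 0
  then show ?case by simp
next
  case (Suc l)
  let ?I = "{s \<in> I. e s l = m l}"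
  have "(\<Sum>s\<in>?I. scale (\<Prod>j<l. t j ^ e s j) (X s)) \<in> V" for t
  proof (rule coefficient_extraction_single[OF V \<open>finite I\<close>, where e = "\<lambda>s. e s l"])
    fix u
    have "(\<Prod>j<Suc l. (t(l := u)) j ^ e s j) = u ^ e s l * (\<Prod>j<l. t j ^ e s j)" for s
      by (simp add: mult.commute)
    then show "(\<Sum>s\<in>I. scale (u ^ e s l) (scale (\<Prod>j<l. t j ^ e s j) (X s))) \<in> V"
      using Suc.prems(2)[of "t(l := u)"] by (simp only: scale_scale)
  qed
  then have "(\<Sum>s | s \<in> ?I \<and> (\<forall>j<l. e s j = m j). X s) \<in> V"
    using Suc.prems(1) by (intro Suc.IH) auto
  moreover have "{s. s \<in> ?I \<and> (\<forall>j<l. e s j = m j)} = {s. s \<in> I \<and> (\<forall>j<Suc l. e s j = m j)}"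
    by (auto simp: less_Suc_eq)
  ultimately show ?case by simp
qed

lemma word_product_scale:
  assumes "unital TYPE('a) \<or> ks \<noteq> []"
  shows "word_product (map (\<lambda>k. scale (t k) (b k)) ks)
    = scale (prod_list (map t ks)) (word_product (map b ks) :: 'a)"
proof (cases "ks = []")
  case False
  then show ?thesis
  proof (induction ks)
    case (Cons k ks)
    then show ?case
      by (cases "ks = []") (simp_all add: word_product_Cons scale_mult_left scale_mult_right mult.commute)
  qed simp
qed simp

text \<open>
  The part of \<open>f(\<Sum>\<^sub>j t\<^sub>j b\<^sub>j)\<close>, where \<open>b\<^sub>j\<close> is placed at the variable \<open>w\<^sub>j\<close>, that is linear in each
  of the parameters \<open>t\<^sub>j\<close>. Each \<open>b\<^sub>j\<close> occurs exactly once, so the sum runs over the orders of the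
  \<open>b\<^sub>j\<close>, and the coefficient is that of the word which the variables form in this order.
\<close>

definition polarisation :: "'k free_algebra \<Rightarrow> nat list \<Rightarrow> (nat \<Rightarrow> 'a) \<Rightarrow> 'a"
  where "polarisation f w b = (\<Sum>ks\<in>permutations_of_set {..<length w}.
    scale (Poly_Mapping.lookup f (Word (map ((!) w) ks))) (word_product (map b ks)))"

lemma prod_list_eq_prod_count:
  fixes t :: "nat \<Rightarrow> 'k"
  assumes "set ks \<subseteq> {..<l}"
  shows "prod_list (map t ks) = (\<Prod>j<l. t j ^ count (mset ks) j)"
  using assms
proof (induction ks)
  case (Cons k ks)
  have "(\<Prod>j<l. t j ^ count (mset (k # ks)) j) = (\<Prod>j<l. (if j = k then t j else 1) * t j ^ count (mset ks) j)"
    by (intro prod.cong refl) auto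
  also have "\<dots> = t k * (\<Prod>j<l. t j ^ count (mset ks) j)"
    using Cons.prems by (simp add: prod.distrib)
  finally show ?case using Cons by simp
qed simp

lemma permutations_of_set_eq_count:
  "permutations_of_set {..<l} = {ks \<in> lists {..<l}. \<forall>j<l. count (mset ks) j = 1}"
proof (intro set_eqI iffI)
  fix ks assume "ks \<in> permutations_of_set {..<l}"
  then show "ks \<in> {ks \<in> lists {..<l}. \<forall>j<l. count (mset ks) j = 1}"
    by (auto simp: permutations_of_set_def distinct_count_atmost_1)
next
  fix ks assume a: "ks \<in> {ks \<in> lists {..<l}. \<forall>j<l. count (mset ks) j = 1}"
  have "j \<in> set ks" if "j < l" for j
  proof (rule ccontr)
    assume "j \<notin> set ks"
    then have "count (mset ks) j = 0" by (simp add: not_in_iff[symmetric])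
    with a that show False by auto
  qed
  then have s: "set ks = {..<l}" using a by auto
  moreover have "distinct ks"
    unfolding distinct_count_atmost_1 using a s by (auto simp: not_in_iff[symmetric])
  ultimately show "ks \<in> permutations_of_set {..<l}" by (simp add: permutations_of_set_def)
qed

text \<open>
  The polarisation is the coefficient of \<open>\<Prod>\<^sub>j t\<^sub>j\<close> in a polynomial whose values are values of \<open>f\<close>.
\<close>

lemma polarisation_in_subspace:
  assumes f: "evaluable TYPE('a) f" and V: "subspace V" and val: "\<And>a. poly_value f a \<in> V"
  shows "polarisation f w b \<in> V"
proof -
  let ?l = "length w" and ?\<pi> = "(!) w"
  let ?I = "{ks. ks \<in> lists {..<?l} \<and> Word (map ?\<pi> ks) \<in> Poly_Mapping.keys f}"
  let ?X = "\<lambda>ks. scale (Poly_Mapping.lookup f (Word (map ?\<pi> ks))) (word_product (map b ks))"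
  have fin: "finite ?I" by (rule poly_value_fibre_sums(2)) simp
  have "(\<Sum>ks | ks \<in> ?I \<and> (\<forall>j<?l. count (mset ks) j = 1). ?X ks) \<in> V"
  proof (rule coefficient_extraction[OF V fin])
    fix t :: "nat \<Rightarrow> 'k"
    have "poly_value f (\<lambda>x. \<Sum>k | k \<in> {..<?l} \<and> ?\<pi> k = x. scale (t k) (b k)) =
        (\<Sum>ks\<in>?I. scale (Poly_Mapping.lookup f (Word (map ?\<pi> ks)))
            (word_product (map (\<lambda>k. scale (t k) (b k)) ks)))"
      by (rule poly_value_fibre_sums(1)) simp
    also have "\<dots> = (\<Sum>ks\<in>?I. scale (\<Prod>j<?l. t j ^ count (mset ks) j) (?X ks))"
    proof (rule sum.cong[OF refl])
      fix ks assume ks: "ks \<in> ?I"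
      then have "unital TYPE('a) \<or> ks \<noteq> []" using evaluable_word[OF f, of "Word (map ?\<pi> ks)"] by auto
      moreover have "prod_list (map t ks) = (\<Prod>j<?l. t j ^ count (mset ks) j)"
        using ks by (intro prod_list_eq_prod_count) auto
      ultimately show "scale (Poly_Mapping.lookup f (Word (map ?\<pi> ks)))
            (word_product (map (\<lambda>k. scale (t k) (b k)) ks)) = scale (\<Prod>j<?l. t j ^ count (mset ks) j) (?X ks)"
        by (simp add: word_product_scale mult.commute)
    qed
    finally show "(\<Sum>ks\<in>?I. scale (\<Prod>j<?l. t j ^ count (mset ks) j) (?X ks)) \<in> V"
      using val by metis
  qed
  also have "(\<Sum>ks | ks \<in> ?I \<and> (\<forall>j<?l. count (mset ks) j = 1). ?X ks) = polarisation f w b"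
    unfolding polarisation_def
    by (rule sum.mono_neutral_left[OF finite_permutations_of_set]) (auto simp: permutations_of_set_eq_count in_keys_iff)
  finally show ?thesis .
qed

lemma sum_over_permuted_lists:
  assumes J: "finite J" and ks: "ks \<in> permutations_of_set {..<l}"
  shows "(\<Sum>w | w \<in> lists J \<and> length w = l. h (map ((!) w) ks)) = (\<Sum>w | w \<in> lists J \<and> length w = l. h w)"
proof -
  let ?S = "{w. w \<in> lists J \<and> length w = l}" and ?p = "\<lambda>w. map ((!) w) ks"
  have set: "set ks = {..<l}" and dist: "distinct ks"
    using ks by (simp_all add: permutations_of_set_def)
  have len: "length ks = l"
    using distinct_card[OF dist] set by simp
  have fin: "finite ?S" using finite_lists_length_eq[OF J, of l] by (simp add: lists_eq_set)
  have into: "?p ` ?S \<subseteq> ?S" using set len by (auto simp: in_lists_conv_set)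
  have inj: "inj_on ?p ?S"
  proof (rule inj_onI)
    fix v w assume v: "v \<in> ?S" and w: "w \<in> ?S" and eq: "?p v = ?p w"
    then have "\<forall>k\<in>{..<l}. v ! k = w ! k" using set by (metis map_eq_conv)
    then show "v = w" using v w by (intro nth_equalityI) auto
  qed
  have "?p ` ?S = ?S" by (rule endo_inj_surj[OF fin into inj])
  then show ?thesis using sum.reindex[OF inj, of h] by simp
qed

text \<open>
  A value of \<open>f\<close> is recovered from polarisations: summing the polarisations over all index lists
  of length \<open>l\<close> counts every summand of degree \<open>l\<close> of the value once for each permutation, hence
  gives \<open>l!\<close> times the homogeneous component of degree \<open>l\<close>. The fibres of \<open>\<pi>\<close> allow the
  arguments of \<open>f\<close> to be split into summands, so that only polarisations at the summands are
  involved.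
\<close>

lemma poly_value_in_subspace:
  fixes q :: "'j \<Rightarrow> 'a"
  assumes J: "finite J" and W: "subspace W"
    and pol: "\<And>ks. ks \<in> lists J \<Longrightarrow> polarisation f (map \<pi> ks) (\<lambda>i. q (ks ! i)) \<in> W"
  shows "poly_value f (\<lambda>x. \<Sum>k | k \<in> J \<and> \<pi> k = x. q k) \<in> W"
proof -
  let ?h = "\<lambda>ks. scale (Poly_Mapping.lookup f (Word (map \<pi> ks))) (word_product (map q ks))"
  let ?K = "{ks. ks \<in> lists J \<and> Word (map \<pi> ks) \<in> Poly_Mapping.keys f}"
  let ?L = "\<lambda>l. {ks. ks \<in> lists J \<and> length ks = l}"
  have finL: "finite (?L l)" for l
    using finite_lists_length_eq[OF J, of l] by (simp add: lists_eq_set)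
  have finK: "finite ?K" by (rule poly_value_fibre_sums(2)[OF J])
  have homogeneous: "sum ?h (?L l) \<in> W" for l
  proof -
    have "(\<Sum>ks\<in>?L l. polarisation f (map \<pi> ks) (\<lambda>i. q (ks ! i)))
        = (\<Sum>ks\<in>?L l. \<Sum>is\<in>permutations_of_set {..<l}. ?h (map ((!) ks) is))"
    proof (rule sum.cong[OF refl])
      fix ks assume ks: "ks \<in> ?L l"
      have "map ((!) (map \<pi> ks)) is = map \<pi> (map ((!) ks) is)" if "is \<in> permutations_of_set {..<l}" for "is"
        using that ks by (auto simp: permutations_of_set_def)
      moreover have "map (\<lambda>i. q (ks ! i)) is = map q (map ((!) ks) is)" for "is" by simp
      ultimately show "polarisation f (map \<pi> ks) (\<lambda>i. q (ks ! i))
          = (\<Sum>is\<in>permutations_of_set {..<l}. ?h (map ((!) ks) is))"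
        using ks unfolding polarisation_def by (intro sum.cong) (simp_all only: length_map mem_Collect_eq)
    qed
    also have "\<dots> = (\<Sum>is\<in>permutations_of_set {..<l}. \<Sum>ks\<in>?L l. ?h (map ((!) ks) is))"
      by (rule sum.swap)
    also have "\<dots> = (\<Sum>is\<in>permutations_of_set {..<l}. sum ?h (?L l))"
      by (intro sum.cong refl sum_over_permuted_lists[OF J])
    also have "\<dots> = scale (fact l) (sum ?h (?L l))"
      by (simp add: sum_constant_scale card_permutations_of_set)
    finally have eq: "(\<Sum>ks\<in>?L l. polarisation f (map \<pi> ks) (\<lambda>i. q (ks ! i))) = scale (fact l) (sum ?h (?L l))" .
    have "scale (fact l) (sum ?h (?L l)) \<in> W"
      unfolding eq[symmetric] by (intro subspace_sum[OF W]) (auto intro: pol)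
    then show ?thesis by (rule subspace_scale_cancel[OF W, rotated]) simp
  qed
  have "poly_value f (\<lambda>x. \<Sum>k | k \<in> J \<and> \<pi> k = x. q k) = sum ?h ?K"
    by (rule poly_value_fibre_sums(1)[OF J])
  also have "\<dots> = (\<Sum>l\<in>length ` ?K. sum ?h {ks \<in> ?K. length ks = l})"
    by (rule sum.group[symmetric]) (use finK in auto)
  also have "\<dots> = (\<Sum>l\<in>length ` ?K. sum ?h (?L l))"
    by (intro sum.cong refl sum.mono_neutral_left) (use finL in \<open>auto simp: in_keys_iff\<close>)
  also have "\<dots> \<in> W" by (intro subspace_sum[OF W] homogeneous)
  finally show ?thesis .
qed


section \<open>Homogeneous products obtained from the values of a polynomial\<close>

text \<open>
  The scalar depends on the degrees \<open>d\<close> and on the two orders, but not on the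
  factors \<open>b\<close>. The first index of \<open>ks\<close> is moved to its place in \<open>js\<close> by commuting it
  past its predecessors, and the other indices are sorted by induction.
\<close>

lemma word_product_permute:
  fixes A :: "'g \<Rightarrow> 'a set"
  assumes comm: "\<forall>g h. \<forall>a\<in>A g. \<forall>b\<in>A h. a * b = scale (\<beta> g h) (b * a)"
  shows "mset ks = mset js \<Longrightarrow> \<exists>c. \<forall>b. (\<forall>k\<in>set ks. b k \<in> A (d k)) \<longrightarrow>
    word_product (map b ks) = scale c (word_product (map b js))"
proof (induction ks arbitrary: js)
  case Nil
  then show ?case by (auto intro: exI[of _ 1])
next
  case (Cons k ks)
  have swap: "\<exists>c. \<forall>b. (\<forall>k\<in>set (xs @ k # ys). b k \<in> A (d k)) \<longrightarrow>
      word_product (map b (k # xs @ ys)) = scale c (word_product (map b (xs @ k # ys)))" for xs ys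
  proof (induction xs)
    case Nil
    show ?case by (auto intro: exI[of _ 1])
  next
    case (Cons x xs)
    then obtain c where c: "\<And>b. (\<forall>k\<in>set (xs @ k # ys). b k \<in> A (d k)) \<Longrightarrow>
        word_product (map b (k # xs @ ys)) = scale c (word_product (map b (xs @ k # ys)))" by blast
    have "word_product (map b (k # (x # xs) @ ys))
        = scale (\<beta> (d k) (d x) * c) (word_product (map b ((x # xs) @ k # ys)))"
      if b: "\<forall>j\<in>set ((x # xs) @ k # ys). b j \<in> A (d j)" for b
    proof -
      have "word_product (map b (k # (x # xs) @ ys))
          = scale (\<beta> (d k) (d x)) (b x * word_product (map b (k # xs @ ys)))"
        using comm[rule_format, of "b k" "d k" "b x" "d x"] b
        by (cases "xs @ ys = []") (simp_all add: word_product_Cons mult.assoc[symmetric] scale_mult_left)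
      also have "b x * word_product (map b (k # xs @ ys))
          = scale c (b x * word_product (map b (xs @ k # ys)))"
        using c[of b] b by (simp add: scale_mult_right)
      finally show ?thesis by (simp add: word_product_Cons)
    qed
    then show ?case by blast
  qed
  have "k \<in> set js" using Cons.prems by (metis list.set_intros(1) set_mset_mset)
  then obtain xs ys where js: "js = xs @ k # ys" by (meson split_list)
  with Cons.prems have "mset ks = mset (xs @ ys)" by simp
  from Cons.IH[OF this] obtain c where c: "\<And>b. (\<forall>k\<in>set ks. b k \<in> A (d k)) \<Longrightarrow>
      word_product (map b ks) = scale c (word_product (map b (xs @ ys)))" by blast
  from swap[of xs ys] obtain c' where c': "\<And>b. (\<forall>k\<in>set (xs @ k # ys). b k \<in> A (d k)) \<Longrightarrow>
      word_product (map b (k # xs @ ys)) = scale c' (word_product (map b (xs @ k # ys)))" by blast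
  have sets: "set (k # ks) = set js" using Cons.prems by (metis set_mset_mset)
  \<comment> \<open>The induction hypothesis cannot be multiplied by the first factor if \<open>ks\<close> is empty, since the
      empty product need not be a unity.\<close>
  have "\<exists>c. \<forall>b. (\<forall>j\<in>set ks. b j \<in> A (d j)) \<longrightarrow>
      word_product (map b (k # ks)) = scale c (word_product (map b (k # xs @ ys)))"
  proof (cases "ks = []")
    case True
    with \<open>mset ks = mset (xs @ ys)\<close> show ?thesis by (auto intro: exI[of _ 1])
  next
    case False
    with \<open>mset ks = mset (xs @ ys)\<close> have "xs @ ys \<noteq> []" by (metis mset_zero_iff)
    with False c have "\<forall>b. (\<forall>j\<in>set ks. b j \<in> A (d j)) \<longrightarrow>
        word_product (map b (k # ks)) = scale c (word_product (map b (k # xs @ ys)))"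
      by (simp add: word_product_Cons scale_mult_right)
    then show ?thesis by blast
  qed
  then obtain c'' where c'': "\<And>b. (\<forall>j\<in>set ks. b j \<in> A (d j)) \<Longrightarrow>
      word_product (map b (k # ks)) = scale c'' (word_product (map b (k # xs @ ys)))" by blast
  have "word_product (map b (k # ks)) = scale (c'' * c') (word_product (map b js))"
    if b: "\<forall>k\<in>set (k # ks). b k \<in> A (d k)" for b
  proof -
    have "\<forall>j\<in>set (xs @ k # ys). b j \<in> A (d j)" using b unfolding sets js .
    from c'[OF this] c''[of b] b show ?thesis by (metis js scale_scale list.set_intros(2))
  qed
  then show ?case by blast
qed

lemma polarisation_homogeneous:
  fixes A :: "'g \<Rightarrow> 'a set"
  assumes comm: "\<forall>g h. \<forall>a\<in>A g. \<forall>b\<in>A h. a * b = scale (\<beta> g h) (b * a)"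
  obtains C where "\<And>b. (\<And>k. k < length w \<Longrightarrow> b k \<in> A (d k)) \<Longrightarrow>
    polarisation f w b = scale C (word_product (map b [0..<length w]))"
proof -
  let ?l = "length w"
  have "\<exists>c. \<forall>b. (\<forall>k\<in>set ks. b k \<in> A (d k)) \<longrightarrow>
      word_product (map b ks) = scale c (word_product (map b [0..<?l]))"
    if "ks \<in> permutations_of_set {..<?l}" for ks
  proof -
    have "mset ks = mset [0..<?l]"
      using that set_eq_iff_mset_eq_distinct[of ks "[0..<?l]"]
      by (simp add: permutations_of_set_def atLeast0LessThan)
    from word_product_permute[OF comm this] show ?thesis by blast
  qed
  then have "\<forall>ks\<in>permutations_of_set {..<?l}. \<exists>c. \<forall>b. (\<forall>k\<in>set ks. b k \<in> A (d k)) \<longrightarrow>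
      word_product (map b ks) = scale c (word_product (map b [0..<?l]))" by blast
  from bchoice[OF this] obtain c where c: "\<And>ks b. ks \<in> permutations_of_set {..<?l} \<Longrightarrow>
      \<forall>k\<in>set ks. b k \<in> A (d k) \<Longrightarrow>
      word_product (map b ks) = scale (c ks) (word_product (map b [0..<?l]))" by blast
  show ?thesis
  proof (rule that)
    fix b assume b: "\<And>k. k < ?l \<Longrightarrow> b k \<in> A (d k)"
    have "\<forall>k\<in>set ks. b k \<in> A (d k)" if "ks \<in> permutations_of_set {..<?l}" for ks
      using that b by (auto simp: permutations_of_set_def)
    then show "polarisation f w b = scale (\<Sum>ks\<in>permutations_of_set {..<?l}.
        Poly_Mapping.lookup f (Word (map ((!) w) ks)) * c ks) (word_product (map b [0..<?l]))"
      unfolding polarisation_def scale_sum_left by (intro sum.cong refl) (simp add: c)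
  qed
qed

text \<open>
  Splitting the arguments of the value outside \<open>W\<close> into homogeneous components shows that some
  polarisation at homogeneous elements lies outside \<open>W\<close>. It is a scalar multiple of the product of
  these elements, and the scalar \<open>C\<close> is nonzero. For other elements of the same degrees \<open>C\<close> is
  the same, and the polarisation lies in \<open>V\<close>; dividing by \<open>C\<close> shows that so does their product.
  The list of degrees can be empty only if the algebra has a unity, because otherwise \<open>f\<close> has no
  constant term.
\<close>

lemma homogeneous_products_from_values:
  fixes A :: "'g::{finite,ab_group_add} \<Rightarrow> 'a set"
  assumes A: "grading A"
    and comm: "\<forall>g h. \<forall>a\<in>A g. \<forall>b\<in>A h. a * b = scale (\<beta> g h) (b * a)"
    and f: "evaluable TYPE('a) f"
    and V: "subspace V" "\<And>a. poly_value f a \<in> V"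
    and W: "subspace W" "poly_value f a \<notin> W"
  obtains gs where "unital TYPE('a) \<or> gs \<noteq> []"
    and "\<And>bs. list_all2 (\<lambda>b g. b \<in> A g) bs gs \<Longrightarrow> word_product bs \<in> V"
    and "\<exists>bs. list_all2 (\<lambda>b g. b \<in> A g) bs gs \<and> word_product bs \<notin> W"
proof -
  have "\<exists>c. (\<forall>g. c g \<in> A g) \<and> x = (\<Sum>g\<in>UNIV. c g)" for x using A unfolding grading_def by blast
  then obtain c where c: "\<And>x g. c x g \<in> A g" "\<And>x. x = (\<Sum>g\<in>UNIV. c x g)" by metis
  let ?J = "variables f \<times> (UNIV :: 'g set)" and ?q = "\<lambda>(x, g). c (a x) g"
  have J: "finite ?J" by (simp add: finite_variables)
  have "poly_value f (\<lambda>x. \<Sum>k | k \<in> ?J \<and> fst k = x. ?q k) = poly_value f a"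
  proof (rule poly_value_cong)
    fix x assume "x \<in> variables f"
    then have "{k \<in> ?J. fst k = x} = Pair x ` UNIV" by auto
    then have "(\<Sum>k | k \<in> ?J \<and> fst k = x. ?q k) = (\<Sum>g\<in>UNIV. c (a x) g)"
      by (simp add: sum.reindex inj_on_def)
    then show "(\<Sum>k | k \<in> ?J \<and> fst k = x. ?q k) = a x" using c(2) by metis
  qed
  with W have "poly_value f (\<lambda>x. \<Sum>k | k \<in> ?J \<and> fst k = x. ?q k) \<notin> W" by metis
  with poly_value_in_subspace[OF J W(1), of f fst ?q]
  obtain ks where ks: "polarisation f (map fst ks) (\<lambda>i. ?q (ks ! i)) \<notin> W" by blast
  let ?l = "length ks"
  obtain C where C: "\<And>b. (\<And>k. k < ?l \<Longrightarrow> b k \<in> A (snd (ks ! k))) \<Longrightarrow>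
      polarisation f (map fst ks) b = scale C (word_product (map b [0..<?l]))"
    using polarisation_homogeneous[OF comm, where w = "map fst ks" and d = "\<lambda>k. snd (ks ! k)" and f = f]
    by (metis length_map)
  have q: "?q (ks ! k) \<in> A (snd (ks ! k))" for k by (simp add: case_prod_beta c)
  have qs: "scale C (word_product (map (\<lambda>i. ?q (ks ! i)) [0..<?l])) \<notin> W"
    using ks C[OF q] by simp
  then have "C \<noteq> 0" using subspace_0[OF W(1)] by auto
  show ?thesis
  proof (rule that[of "map snd ks"])
    show "unital TYPE('a) \<or> map snd ks \<noteq> []"
    proof (rule ccontr)
      assume "\<not> ?thesis"
      then have "ks = []" and "Poly_Mapping.lookup f (Word []) = 0"
        using f by (auto simp: evaluable_def zero_free_monoid_def)
      with ks subspace_0[OF W(1)] show False by (simp add: polarisation_def)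
    qed
  next
    fix bs assume bs: "list_all2 (\<lambda>b g. b \<in> A g) bs (map snd ks)"
    then have len: "length bs = ?l" by (simp add: list_all2_lengthD)
    have "polarisation f (map fst ks) ((!) bs) = scale C (word_product (map ((!) bs) [0..<?l]))"
      using bs len by (intro C) (simp add: list_all2_conv_all_nth)
    also have "map ((!) bs) [0..<?l] = bs" using len map_nth by metis
    finally have "scale C (word_product bs) \<in> V"
      using polarisation_in_subspace[OF f V] by metis
    then show "word_product bs \<in> V" by (rule subspace_scale_cancel[OF V(1) \<open>C \<noteq> 0\<close>])
  next
    have "list_all2 (\<lambda>b g. b \<in> A g) (map (\<lambda>i. ?q (ks ! i)) [0..<?l]) (map snd ks)"
      using q by (simp add: list_all2_conv_all_nth)
    moreover have "word_product (map (\<lambda>i. ?q (ks ! i)) [0..<?l]) \<notin> W"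
      using qs subspace_scale[OF W(1)] by blast
    ultimately show "\<exists>bs. list_all2 (\<lambda>b g. b \<in> A g) bs (map snd ks) \<and> word_product bs \<notin> W" by blast
  qed
qed

lemma word_product_degree:
  fixes A :: "'g::{finite,ab_group_add} \<Rightarrow> 'a set"
  assumes A: "grading A"
  shows "list_all2 (\<lambda>b g. b \<in> A g) bs gs \<Longrightarrow> bs \<noteq> [] \<Longrightarrow> word_product bs \<in> A (sum_list gs)"
proof (induction rule: list_all2_induct)
  case (Cons b bs g gs)
  have mult: "x \<in> A g \<Longrightarrow> y \<in> A h \<Longrightarrow> x * y \<in> A (g + h)" for x y g h
    using A by (simp add: grading_def)
  show ?case
  proof (cases "bs = []")
    case True
    with Cons show ?thesis by simp
  next
    case False
    with Cons show ?thesis by (simp add: word_product_Cons mult)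
  qed
qed simp

end

section \<open>Supercommutative regular algebras\<close>

lemma two_cases: "(g::2) = 0 \<or> g = 1"
proof (cases g)
  case (of_int z)
  then have "z = 0 \<or> z = 1" by auto
  with of_int show ?thesis by auto
qed

lemma two_add: "(1::2) + 1 = 0"
  by simp

locale anticommuting_superalgebra = char_0_algebra scale
  for scale :: "'k::field_char_0 \<Rightarrow> 'a::ring \<Rightarrow> 'a" +
  fixes A :: "2 \<Rightarrow> 'a set"
  assumes regular: "regular_grading A"
    and even_central: "a \<in> A 0 \<Longrightarrow> a \<in> centre"
    and odd_anticommute: "a \<in> A 1 \<Longrightarrow> b \<in> A 1 \<Longrightarrow> a * b = - (b * a)"
begin

lemma grading: "grading A"
  using regular by (simp add: regular_grading_def)

lemma subspace_component: "subspace (A g)"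
  using grading by (simp add: grading_def)

lemma mult_component: "a \<in> A g \<Longrightarrow> b \<in> A h \<Longrightarrow> a * b \<in> A (g + h)"
  using grading by (simp add: grading_def)

lemma components:
  obtains a0 a1 where "a0 \<in> A 0" "a1 \<in> A 1" "a = a0 + a1"
proof -
  obtain c where c: "\<And>g. c g \<in> A g" "a = (\<Sum>g\<in>UNIV. c g)"
    using grading unfolding grading_def by blast
  have "(UNIV :: 2 set) = {0, 1}" using two_cases by auto
  then have "a = c 0 + c 1" using c(2) sum.insert[of "{1::2}" 0 c] by simp
  from that[OF c(1) c(1) this] show ?thesis .
qed

lemma even_odd_zero:
  assumes "a \<in> A 0" "a \<in> A 1"
  shows "a = 0"
proof -
  have U: "(UNIV :: 2 set) = {0, 1}" using two_cases by auto
  let ?c = "\<lambda>g::2. if g = 0 then a else 0" and ?d = "\<lambda>g::2. if g = 1 then a else 0"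
  have c: "(\<forall>g. ?c g \<in> A g) \<and> a = (\<Sum>g\<in>UNIV. ?c g)" and d: "(\<forall>g. ?d g \<in> A g) \<and> a = (\<Sum>g\<in>UNIV. ?d g)"
    using assms subspace_0[OF subspace_component] unfolding U by auto
  obtain c where unique: "\<And>c'. (\<forall>g. c' g \<in> A g) \<and> a = (\<Sum>g\<in>UNIV. c' g) \<longrightarrow> c' = c"
    using grading unfolding grading_def by (metis (no_types, lifting))
  have "?c = ?d" using unique[rule_format, OF c] unique[rule_format, OF d] by simp
  from fun_cong[OF this, of 0] show ?thesis by simp
qed

lemma nonzero_product:
  assumes "gs \<noteq> []"
  obtains bs where "list_all2 (\<lambda>b g. b \<in> A g) bs gs" "word_product bs \<noteq> 0"
proof -
  obtain bs where "list_all2 (\<lambda>b g. b \<in> A g) bs gs" "list_product bs \<noteq> 0"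
    using regular assms unfolding regular_grading_def by blast
  moreover from this assms have "bs \<noteq> []" by auto
  ultimately show ?thesis using that by (simp add: word_product_def)
qed

lemma homogeneous_products:
  assumes "evaluable TYPE('a) f"
    and "subspace V" "\<And>a. poly_value f a \<in> V"
    and "subspace W" "poly_value f a \<notin> W"
  obtains gs where "unital TYPE('a) \<or> gs \<noteq> []"
    and "\<And>bs. list_all2 (\<lambda>b g. b \<in> A g) bs gs \<Longrightarrow> word_product bs \<in> V"
    and "\<exists>bs. list_all2 (\<lambda>b g. b \<in> A g) bs gs \<and> word_product bs \<notin> W"
proof -
  obtain \<beta> where "\<forall>g h. \<forall>a\<in>A g. \<forall>b\<in>A h. a * b = scale (\<beta> g h) (b * a)"
    using regular unfolding regular_grading_def by metis
  from homogeneous_products_from_values[OF grading this assms] that show ?thesis by metis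
qed

lemma centre_commute: "z \<in> centre \<Longrightarrow> z * a = a * z"
  by (simp add: centre_def)

lemma odd_square: "\<eta> \<in> A 1 \<Longrightarrow> \<eta> * \<eta> = 0"
  using odd_anticommute eq_minus_imp_zero by blast

text \<open>
  In an algebra with unity, \<open>\<phi>\<close> is conjugation by \<open>1 + \<eta>/2\<close>, whose inverse is \<open>1 - \<eta>/2\<close> because
  \<open>\<eta>\<^sup>2 = 0\<close>. In general, \<open>\<phi>\<close> is multiplicative because \<open>[\<eta>, _]\<close> is a derivation and
  \<open>[\<eta>, x][\<eta>, y] = 4 \<eta> x\<^sub>1 \<eta> y\<^sub>1 = 0\<close>, where \<open>x\<^sub>1\<close> and \<open>y\<^sub>1\<close> are the odd components.
\<close>

lemma odd_inner_endomorphism: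
  fixes \<eta> :: 'a
  defines "\<phi> \<equiv> \<lambda>a. a + scale (1/2) (\<eta> * a - a * \<eta>)"
  assumes \<eta>: "\<eta> \<in> A 1" and f: "evaluable TYPE('a) f"
  shows "poly_value f (\<lambda>x. \<phi> (a x)) = \<phi> (poly_value f a)"
proof (rule poly_value_endomorphism[OF f])
  fix x y
  show "\<phi> (x + y) = \<phi> x + \<phi> y"
    by (simp add: \<phi>_def algebra_simps scale_right_distrib scale_right_diff_distrib)
  have comm: "\<exists>z1\<in>A 1. \<eta> * z - z * \<eta> = \<eta> * z1 + \<eta> * z1" for z
  proof -
    obtain z0 z1 where z: "z0 \<in> A 0" "z1 \<in> A 1" "z = z0 + z1" by (rule components)
    then have "\<eta> * z - z * \<eta> = \<eta> * z1 + \<eta> * z1"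
      using centre_commute[OF even_central[OF z(1)], of \<eta>] odd_anticommute[OF z(2) \<eta>]
      by (simp add: algebra_simps)
    with z show ?thesis by blast
  qed
  have "(\<eta> * x1) * (\<eta> * y1) = 0" if "x1 \<in> A 1" for x1 y1
  proof -
    have "(\<eta> * x1) * (\<eta> * y1) = \<eta> * (x1 * \<eta>) * y1" by (simp add: mult.assoc)
    also have "\<dots> = - ((\<eta> * \<eta>) * x1 * y1)" using odd_anticommute[OF that \<eta>] by (simp add: mult.assoc)
    finally show ?thesis using odd_square[OF \<eta>] by simp
  qed
  then have "(\<eta> * x - x * \<eta>) * (\<eta> * y - y * \<eta>) = 0"
    using comm[of x] comm[of y] by (auto simp: distrib_left distrib_right)
  moreover have "\<eta> * (x * y) - x * y * \<eta> = (\<eta> * x - x * \<eta>) * y + x * (\<eta> * y - y * \<eta>)"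
    by (simp add: algebra_simps)
  ultimately show "\<phi> (x * y) = \<phi> x * \<phi> y"
    by (simp add: \<phi>_def distrib_left distrib_right scale_mult_left scale_mult_right scale_right_distrib)
next
  fix c x
  show "\<phi> (scale c x) = scale c (\<phi> x)"
    by (simp add: \<phi>_def scale_mult_left scale_mult_right scale_right_distrib scale_right_diff_distrib mult.commute)
next
  fix e :: 'a assume "is_unity e"
  then show "\<phi> e = e" by (simp add: \<phi>_def is_unity_def)
qed

text \<open>
  Applying the endomorphism to the arguments of \<open>f\<close> turns a value \<open>y\<close> into \<open>y + \<eta>y\<close>. Both are
  odd, whereas \<open>\<eta>y\<close> is even; hence \<open>\<eta>y = 0\<close>. With \<open>V\<close> the annihilator of the odd part, a nonzero
  value would make \<open>\<eta> b\<^sub>1 \<cdots> b\<^sub>l\<close> vanish for all odd \<open>\<eta>\<close> and all \<open>b\<^sub>j\<close> of certain degrees.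
\<close>

lemma odd_valued_imp_zero:
  assumes f: "evaluable TYPE('a) f" and odd: "\<And>a. poly_value f a \<in> A 1"
  shows "poly_value f a = 0"
proof (rule ccontr)
  assume nz: "poly_value f a \<noteq> 0"
  let ?V = "{y. \<forall>\<eta>\<in>A 1. \<eta> * y = 0}"
  have annihilated: "\<eta> * poly_value f a = 0" if \<eta>: "\<eta> \<in> A 1" for \<eta> a
  proof (rule even_odd_zero)
    let ?y = "poly_value f a"
    show "\<eta> * ?y \<in> A 0" using mult_component[OF \<eta> odd] by (simp only: two_add)
    have "scale (1/2) (\<eta> * ?y - ?y * \<eta>) = \<eta> * ?y"
      using odd_anticommute[OF odd \<eta>] scale_left_distrib[of "1/2" "1/2"] by (simp add: scale_right_distrib)
    then have "poly_value f (\<lambda>x. a x + scale (1/2) (\<eta> * a x - a x * \<eta>)) = ?y + \<eta> * ?y"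
      using odd_inner_endomorphism[OF \<eta> f, of a] by simp
    then have "\<eta> * ?y = poly_value f (\<lambda>x. a x + scale (1/2) (\<eta> * a x - a x * \<eta>)) - ?y" by simp
    then show "\<eta> * ?y \<in> A 1" using subspace_diff[OF subspace_component odd odd] by simp
  qed
  have V: "subspace ?V"
    by (auto simp: subspace_def distrib_left scale_mult_right)
  obtain gs where gs: "unital TYPE('a) \<or> gs \<noteq> []"
      "\<And>bs. list_all2 (\<lambda>b g. b \<in> A g) bs gs \<Longrightarrow> word_product bs \<in> ?V"
    by (rule homogeneous_products[OF f V _ subspace_single_0, of a]) (use annihilated nz in auto)
  obtain cs where cs: "list_all2 (\<lambda>b g. b \<in> A g) cs (1 # gs)" "word_product cs \<noteq> 0"
    using nonzero_product[of "1 # gs"] by blast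
  then obtain \<eta> bs where *: "cs = [\<eta>] @ bs" "\<eta> \<in> A 1" "list_all2 (\<lambda>b g. b \<in> A g) bs gs"
    by (auto simp: list_all2_Cons2)
  then have "word_product cs = \<eta> * word_product bs"
    using gs(1) by (subst *(1), subst word_product_append) auto
  with gs(2)[OF *(3)] *(2) cs(2) show False by simp
qed

text \<open>
  The core of the proof. The values of \<open>f\<close> and then those of \<open>g\<close> are traded for
  products of homogeneous elements, of total degree 1 and 0 respectively. The product of both
  is then odd and central, so it both commutes and anticommutes with every odd \<open>\<eta>\<close>.
\<close>

lemma central_left_factor:
  assumes f: "evaluable TYPE('a) f" and g: "evaluable TYPE('a) g"
    and central: "\<And>a b. poly_value f a * poly_value g b \<in> centre"
    and nz: "poly_value g b \<noteq> 0"
  shows "poly_value f a \<in> centre"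
proof (rule ccontr)
  assume not_central: "poly_value f a \<notin> centre"
  let ?V = "{x. \<forall>b. x * poly_value g b \<in> centre}"
  have V: "subspace ?V"
    using centre_subspace by (auto simp: subspace_def distrib_right scale_mult_left)
  obtain gs where gs: "unital TYPE('a) \<or> gs \<noteq> []"
      "\<And>bs. list_all2 (\<lambda>b g. b \<in> A g) bs gs \<Longrightarrow> word_product bs \<in> ?V"
      "\<exists>bs. list_all2 (\<lambda>b g. b \<in> A g) bs gs \<and> word_product bs \<notin> centre"
    by (rule homogeneous_products[OF f V _ centre_subspace not_central]) (use central in auto)
  then obtain bs0 where bs0: "list_all2 (\<lambda>b g. b \<in> A g) bs0 gs" "word_product bs0 \<notin> centre" by blast
  have "bs0 \<noteq> []"
  proof
    assume "bs0 = []"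
    with bs0 gs(1) have "is_unity (word_product bs0)" using word_product_Nil by auto
    then show False using bs0(2) by (simp add: is_unity_def centre_def)
  qed
  then have "gs \<noteq> []" using bs0 by auto
  have "sum_list gs \<noteq> 0"
    using word_product_degree[OF grading bs0(1) \<open>bs0 \<noteq> []\<close>] bs0(2) even_central by auto
  then have odd_f: "sum_list gs = 1" using two_cases by blast

  have "\<exists>b. poly_value g b \<notin> A 1" using odd_valued_imp_zero[OF g] nz by blast
  then obtain b' where b': "poly_value g b' \<notin> A 1" by blast
  let ?U = "{y. \<forall>bs. list_all2 (\<lambda>b g. b \<in> A g) bs gs \<longrightarrow> word_product bs * y \<in> centre}"
  have U: "subspace ?U"
    using centre_subspace by (auto simp: subspace_def distrib_left scale_mult_right)
  obtain hs where hs: "unital TYPE('a) \<or> hs \<noteq> []"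
      "\<And>cs. list_all2 (\<lambda>b g. b \<in> A g) cs hs \<Longrightarrow> word_product cs \<in> ?U"
      "\<exists>cs. list_all2 (\<lambda>b g. b \<in> A g) cs hs \<and> word_product cs \<notin> A 1"
    by (rule homogeneous_products[OF g U _ subspace_component b']) (use gs(2) in auto)
  \<comment> \<open>For \<open>hs = []\<close> the algebra has a unity, and the empty product has degree 0 as well.\<close>
  have even_g: "sum_list hs = 0"
  proof (cases "hs = []")
    case False
    from hs(3) obtain cs where cs: "list_all2 (\<lambda>b g. b \<in> A g) cs hs" "word_product cs \<notin> A 1" by blast
    with False have "cs \<noteq> []" by auto
    from word_product_degree[OF grading cs(1) this] cs(2) have "sum_list hs \<noteq> 1" by auto
    then show ?thesis using two_cases by blast
  qed simp

  \<comment> \<open>The extra odd factor at the end is the one that an odd central element must annihilate.\<close>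
  obtain ds where ds: "list_all2 (\<lambda>b g. b \<in> A g) ds (gs @ hs @ [1])" "word_product ds \<noteq> 0"
    using nonzero_product[of "gs @ hs @ [1]"] by blast
  then obtain bs cs \<eta> where *: "ds = (bs @ cs) @ [\<eta>]" "list_all2 (\<lambda>b g. b \<in> A g) bs gs"
      "list_all2 (\<lambda>b g. b \<in> A g) cs hs" "\<eta> \<in> A 1"
    by (auto simp: list_all2_append2 list_all2_Cons2)
  define z where "z = word_product (bs @ cs)"
  have "bs \<noteq> []" using *(2) \<open>gs \<noteq> []\<close> by auto
  then have ds_eq: "word_product ds = z * \<eta>"
    unfolding *(1) z_def by (subst word_product_append) auto
  have "z = word_product bs * word_product cs"
    unfolding z_def using *(3) \<open>bs \<noteq> []\<close> hs(1) by (intro word_product_append) auto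
  then have "z \<in> centre" using hs(2)[OF *(3)] *(2) by auto
  moreover have "z \<in> A 1"
    using word_product_degree[OF grading list_all2_appendI[OF *(2,3)]] \<open>bs \<noteq> []\<close> odd_f even_g
    by (simp add: z_def)
  ultimately have "z * \<eta> = - (z * \<eta>)"
    using odd_anticommute[OF _ *(4), of z] centre_commute[of z \<eta>] by simp
  then have "z * \<eta> = 0" by (rule eq_minus_imp_zero)
  with ds(2) ds_eq show False by simp
qed

text \<open>
  Only the odd components contribute to a commutator, and \<open>[a\<^sub>1, b\<^sub>1] = 2 a\<^sub>1 b\<^sub>1\<close> is even. This makes
  the hypothesis of \<open>central_left_factor\<close> symmetric in the two polynomials.
\<close>

lemma commutator_central: "a * b - b * a \<in> (centre :: 'a set)"
proof -
  obtain a0 a1 where a: "a0 \<in> A 0" "a1 \<in> A 1" "a = a0 + a1" by (rule components)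
  obtain b0 b1 where b: "b0 \<in> A 0" "b1 \<in> A 1" "b = b0 + b1" by (rule components)
  have "a * b - b * a = a1 * b1 + a1 * b1"
    using centre_commute[OF even_central[OF a(1)], of b1] centre_commute[OF even_central[OF a(1)], of b0]
      centre_commute[OF even_central[OF b(1)], of a1] odd_anticommute[OF b(2) a(2)]
    by (simp add: a(3) b(3) algebra_simps)
  moreover have "a1 * b1 \<in> centre" using mult_component[OF a(2) b(2)] even_central by (simp only: two_add)
  ultimately show ?thesis using subspace_add[OF centre_subspace] by metis
qed

lemma primeness: primeness_property
  unfolding primeness_property_def
proof (intro allI impI)
  fix f g
  assume f: "evaluable TYPE('a) f" and g: "evaluable TYPE('a) g"
    and disjoint: "variables f \<inter> variables g = {}"
    and proper: "proper_central_polynomial (f * g)"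
  have fg: "poly_value f a * poly_value g b \<in> centre" for a b
  proof -
    let ?c = "\<lambda>x. if x \<in> variables f then a x else b x"
    have "poly_value f ?c = poly_value f a" by (rule poly_value_cong) simp
    moreover have "poly_value g ?c = poly_value g b" by (rule poly_value_cong) (use disjoint in auto)
    ultimately have "poly_value (f * g) ?c = poly_value f a * poly_value g b"
      by (simp add: poly_value_mult[OF f g])
    moreover have "poly_value (f * g) ?c \<in> centre"
      using proper by (simp add: proper_central_polynomial_def central_polynomial_def)
    ultimately show ?thesis by simp
  qed
  have gf: "poly_value g b * poly_value f a \<in> centre" for a b
    using subspace_add[OF centre_subspace fg[of a b] commutator_central[of "poly_value g b" "poly_value f a"]]
    by simp
  obtain c where "poly_value (f * g) c \<noteq> 0"
    using proper by (auto simp: proper_central_polynomial_def central_polynomial_def polynomial_identity_def)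
  then have nz: "poly_value f c \<noteq> 0" "poly_value g c \<noteq> 0" by (auto simp: poly_value_mult[OF f g])
  show "central_polynomial f \<and> central_polynomial g"
    unfolding central_polynomial_def
    using f g central_left_factor[OF f g fg nz(2)] central_left_factor[OF g f gf nz(1)] by blast
qed

end

section \<open>The primeness property for regular gradings by the group of order two\<close>

lemma (in assoc_algebra) primeness_commutative:
  assumes "\<And>a b :: 'a. a * b = b * a"
  shows primeness_property
  using assms by (simp add: primeness_property_def central_polynomial_def centre_def)

text \<open>
  The commutation factor \<open>\<beta>\<close> is determined by computing with products that do not vanish. Moving
  \<open>c\<close> in \<open>abc \<noteq> 0\<close>, with \<open>a\<close>, \<open>b\<close> even, to the front in one step or in two gives
  \<open>\<beta>(0,h) = \<beta>(0,h)\<^sup>2\<close>, so even elements are central. Exchanging two odd factors twice gives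
  \<open>\<beta>(1,1)\<^sup>2 = 1\<close>, and the two signs are the two cases.
\<close>

lemma (in char_0_algebra) regular_two_grading_cases:
  fixes A :: "2 \<Rightarrow> 'a set"
  assumes reg: "regular_grading A"
  shows "(\<forall>a b :: 'a. a * b = b * a) \<or> anticommuting_superalgebra scale A"
proof -
  obtain \<beta> where \<beta>: "\<And>g h a b. a \<in> A g \<Longrightarrow> b \<in> A h \<Longrightarrow> a * b = scale (\<beta> g h) (b * a)"
      and nz: "\<And>g h. \<beta> g h \<noteq> 0"
    using reg unfolding regular_grading_def by metis
  have grad: "grading A" using reg by (simp add: regular_grading_def)
  then have mult: "\<And>g h a b. a \<in> A g \<Longrightarrow> b \<in> A h \<Longrightarrow> a * b \<in> A (g + h)" by (simp add: grading_def)
  have product: "\<exists>as. list_all2 (\<lambda>a g. a \<in> A g) as gs \<and> list_product as \<noteq> 0" if "gs \<noteq> []" for gs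
    using reg that by (simp add: regular_grading_def)
  have one: "\<beta> 0 h = 1" for h
  proof -
    obtain a b c where abc: "a \<in> A 0" "b \<in> A 0" "c \<in> A h" "a * b * c \<noteq> 0"
      using product[of "[0, 0, h]"] by (auto simp: list_all2_Cons2 list_product_def)
    have ab: "a * b \<in> A 0" using mult[OF abc(1,2)] by simp
    have "a * b * c = a * (b * c)" by (simp add: mult.assoc)
    also have "\<dots> = scale (\<beta> 0 h) (a * c * b)" using \<beta>[OF abc(2,3)] by (simp add: scale_mult_right mult.assoc)
    also have "\<dots> = scale (\<beta> 0 h * \<beta> 0 h) (c * (a * b))"
      using \<beta>[OF abc(1,3)] by (simp add: scale_mult_left mult.assoc)
    finally have "scale (\<beta> 0 h) (c * (a * b)) = scale (\<beta> 0 h * \<beta> 0 h) (c * (a * b))"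
      using \<beta>[OF ab abc(3)] by simp
    moreover have "c * (a * b) \<noteq> 0" using \<beta>[OF ab abc(3)] abc(4) by auto
    ultimately show ?thesis using nz[of 0 h] by simp
  qed
  have U: "(UNIV :: 2 set) = {0, 1}" using two_cases by auto
  have components: "\<exists>a0\<in>A 0. \<exists>a1\<in>A 1. a = a0 + a1" for a
  proof -
    obtain c where c: "\<And>g. c g \<in> A g" "a = (\<Sum>g\<in>UNIV. c g)"
      using grad unfolding grading_def by blast
    then have "a = c 0 + c 1" unfolding U by simp
    with c(1) show ?thesis by blast
  qed
  have even: "a * b = b * a" if a: "a \<in> A 0" for a b
  proof -
    obtain b0 b1 where b: "b0 \<in> A 0" "b1 \<in> A 1" "b = b0 + b1" using components by blast
    show ?thesis using \<beta>[OF a b(1)] \<beta>[OF a b(2)] by (simp add: b(3) one distrib_left distrib_right)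
  qed
  obtain a b where ab: "a \<in> A 1" "b \<in> A 1" "a * b \<noteq> 0"
    using product[of "[1, 1]"] by (auto simp: list_all2_Cons2 list_product_def)
  have "scale 1 (a * b) = scale (\<beta> 1 1 * \<beta> 1 1) (a * b)"
    using \<beta>[OF ab(1,2)] \<beta>[OF ab(2,1)] by (metis scale_scale scale_one)
  then have "\<beta> 1 1 * \<beta> 1 1 = 1" using ab(3) by (metis scale_cancel_right)
  then have "\<beta> 1 1 = 1 \<or> \<beta> 1 1 = - 1" by (simp add: square_eq_1_iff)
  then show ?thesis
  proof
    assume "\<beta> 1 1 = 1"
    have "a * b = b * a" for a b :: 'a
    proof -
      obtain a0 a1 where a: "a0 \<in> A 0" "a1 \<in> A 1" "a = a0 + a1" using components by blast
      obtain b0 b1 where b: "b0 \<in> A 0" "b1 \<in> A 1" "b = b0 + b1" using components by blast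
      have "a1 * b1 = b1 * a1" using \<beta>[OF a(2) b(2)] \<open>\<beta> 1 1 = 1\<close> by simp
      then have "a0 * b + (a1 * b0 + a1 * b1) = b * a0 + (b0 * a1 + b1 * a1)"
        using even[OF a(1), of b] even[OF b(1), of a1] by (simp only:)
      then show ?thesis by (simp only: a(3) b(3) distrib_left distrib_right add_ac)
    qed
    then show ?thesis by blast
  next
    assume "\<beta> 1 1 = - 1"
    have "anticommuting_superalgebra scale A"
    proof
      show "a \<in> centre" if "a \<in> A 0" for a using even[OF that] unfolding centre_def by blast
      show "a * b = - (b * a)" if "a \<in> A 1" "b \<in> A 1" for a b
        using \<beta>[OF that] \<open>\<beta> 1 1 = - 1\<close> by simp
    qed (rule reg)
    then show ?thesis by blast
  qed
qed

theorem corollary33: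
  fixes scale :: "'k::{alg_closed_field,field_char_0} \<Rightarrow> 'a::ring \<Rightarrow> 'a"
    and A :: "2 \<Rightarrow> 'a set"
  assumes "assoc_algebra scale"
    and "assoc_algebra.regular_grading scale A"
  shows "assoc_algebra.primeness_property scale"
proof -
  interpret char_0_algebra scale using assms(1) by (simp add: char_0_algebra_def)
  from regular_two_grading_cases[OF assms(2)] show ?thesis
    using primeness_commutative anticommuting_superalgebra.primeness by blast
qed

end
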